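(* Let $m,d\in\mathbb{N}$ with $m\ge d\ge 2$ and let $N=m^d$. Let $P_{\Omega^{*}_{\backslash}}$ be the stratified random point set associated with the partition $\Omega^{*}_{\backslash}$ of $[0,1]^d$. Then $$\mathbb{E}\big(L_2^2(D_N,P_{\Omega^{*}_{\backslash}})\big)\le \frac{d}{N^{1+\frac1d}}-\frac{2}{45}\cdot\frac{1}{N^3}\cdot\frac{1}{3^{d-2}},$$ and this is the optimal bound in the family of bounds $\frac{d}{N^{1+1/d}}+\frac{1}{N^3}\cdot\frac{1}{3^{d-2}}\cdot P(\theta)$, $0\le\theta\le\frac\pi2$, i.e. for every $\theta\in[0,\frac\pi2]$, $$\frac{d}{N^{1+\frac1d}}-\frac{2}{45}\cdot\frac{1}{N^3}\cdot\frac{1}{3^{d-2}}\le \frac{d}{N^{1+\frac1d}}+\frac{1}{N^3}\cdot\frac{1}{3^{d-2}}\cdot P(\theta).$$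
   Context: **$L_2$-discrepancy.** For points $t_1,\dots,t_N\in[0,1]^d$ and $P=\{t_1,\dots,t_N\}$, $$L_2(D_N,P)=\Big(\int_{[0,1]^d}\Big|\lambda([0,z))-\frac1N\sum_{i=1}^N\mathbf 1_{[0,z)}(t_i)\Big|^2dz\Big)^{1/2},$$ where $\lambda$ is Lebesgue measure and $[0,z)=\prod_{i=1}^d[0,z_i)$. $L_2^2(D_N,P)$ denotes the square of this quantity. ($D_N$ is only part of the notation.) **Stratified point sets.** For a partition $\Omega=(\Omega_1,\dots,\Omega_N)$ of $[0,1]^d$ (up to null sets) into $N$ sets of volume $1/N$, the stratified random point set $P_\Omega$ consists of $N$ independent random points, the $i$-th one uniformly distributed in $\Omega_i$; $\mathbb{E}$ is expectation with respect to these points. **Partition $\Omega^{*}_{\backslash}$.** Start from the partition of $[0,1]^d$ into the $N=m^d$ axis-parallel cubes of side $\frac1m$ of the regular grid. Let $a_1=\frac{m-2}{m}$, $a_i=\frac{m-1}{m}$ for $2\le i\le d$, $b=\frac1m$, and let $I_d=[a_1,a_1+2b]\times\prod_{i=2}^d[a_i,a_i+b]$, which is the union of two grid cubes. Let $Q_3,\dots,Q_N$ be the remaining $N-2$ grid cubes. Then $\Omega^{*}_{\backslash}=(\Omega^{*}_{1,\backslash},\Omega^{*}_{2,\backslash},Q_3,\dots,Q_N)$, where $$\Omega^{*}_{1,\backslash}=\mathrm{conv}\{(a_1,a_2),(a_1+2b,a_2),(a_1,a_2+b)\}\times\prod_{i=3}^d[a_i,a_i+b]$$ ($\mathrm{conv}$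 denotes convex hull) and $\Omega^{*}_{2,\backslash}$ is the closure of $I_d\setminus\Omega^{*}_{1,\backslash}$. **The function $P$.** For $0\le\theta\le\frac\pi2$, $$P(\theta)=\begin{cases}\frac{2}{45}\tan^3\theta+\frac{2}{15}\tan^2\theta-\frac{\tan\theta}{6}, & 0\le\theta<\arctan\frac12,\\[2pt] -\frac{2}{45}, & \theta=\arctan\frac12,\\[2pt] -\frac{1}{24\tan\theta}+\frac{1}{120\tan^2\theta}+\frac{1}{1440\tan^3\theta}, & \arctan\frac12<\theta\le\frac{\pi}{2},\end{cases}$$ with $\frac1{\tan\theta}$ read as $\cot\theta$ (so it equals $0$ at $\theta=\frac\pi2$). The bound with $P(\theta)$ is the paper's upper bound for the expected squared $L_2$-discrepancy of the stratified point set obtained when $I_d$ is instead cut by the line in the first two coordinates through $(a_1+b,a_2+\frac b2)$ with slope $-\tan\theta$; the partition $\Omega^{*}_{\backslash}$ is the case $\theta=\arctan\frac12$. *)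

theory Defs
  imports "HOL-Probability.Probability"
begin

text \<open>
  The space $\mathbb{R}^d$ is the set of extensional functions on the index set \<open>{1..d}\<close>,
  i.e. the carrier of the product measure below, so that the dimension is an ordinary
  natural number and the coordinates are numbered from 1 to \<open>d\<close>.
\<close>

definition leb :: "nat \<Rightarrow> (nat \<Rightarrow> real) measure" where
  "leb d = (\<Pi>\<^sub>M i\<in>{1..d}. lborel)"

definition unit_cube :: "nat \<Rightarrow> (nat \<Rightarrow> real) set" where
  "unit_cube d = (\<Pi>\<^sub>E i\<in>{1..d}. {0..1})"

definition anchored_box :: "nat \<Rightarrow> (nat \<Rightarrow> real) \<Rightarrow> (nat \<Rightarrow> real) set" where
  "anchored_box d z = (\<Pi>\<^sub>E i\<in>{1..d}. {0..<z i})"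

definition L2_discrepancy :: "nat \<Rightarrow> nat \<Rightarrow> (nat \<Rightarrow> nat \<Rightarrow> real) \<Rightarrow> real" where
  "L2_discrepancy d N t =
     sqrt (LINT z:unit_cube d|leb d.
       \<bar>measure (leb d) (anchored_box d z)
         - (1 / real N) * (\<Sum>i=1..N. indicator (anchored_box d z) (t i))\<bar>\<^sup>2)"

text \<open>Joint law of the \<open>N\<close> independent points, the \<open>i\<close>-th one uniform in \<open>\<Omega> i\<close>.\<close>

definition stratified_law :: "nat \<Rightarrow> nat \<Rightarrow> (nat \<Rightarrow> (nat \<Rightarrow> real) set) \<Rightarrow> (nat \<Rightarrow> nat \<Rightarrow> real) measure"
  where "stratified_law d N \<Omega> = (\<Pi>\<^sub>M i\<in>{1..N}. uniform_measure (leb d) (\<Omega> i))"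

definition expected_L2_discrepancy_sq :: "nat \<Rightarrow> nat \<Rightarrow> (nat \<Rightarrow> (nat \<Rightarrow> real) set) \<Rightarrow> real" where
  "expected_L2_discrepancy_sq d N \<Omega> = (LINT t|stratified_law d N \<Omega>. (L2_discrepancy d N t)\<^sup>2)"

definition grid_cubes :: "nat \<Rightarrow> nat \<Rightarrow> (nat \<Rightarrow> real) set set" where
  "grid_cubes d m =
     (\<lambda>k. \<Pi>\<^sub>E i\<in>{1..d}. {real (k i) / real m .. (real (k i) + 1) / real m})
       ` ({1..d} \<rightarrow>\<^sub>E {0..<m})"

definition corner :: "nat \<Rightarrow> nat \<Rightarrow> real" where
  "corner m i = (if i = 1 then (real m - 2) / real m else (real m - 1) / real m)"

definition merged_box :: "nat \<Rightarrow> nat \<Rightarrow> (nat \<Rightarrow> real) set" where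
  "merged_box d m =
     (\<Pi>\<^sub>E i\<in>{1..d}. {corner m i .. corner m i + (if i = 1 then 2 else 1) * (1 / real m)})"

definition Omega1_star :: "nat \<Rightarrow> nat \<Rightarrow> (nat \<Rightarrow> real) set" where
  "Omega1_star d m =
     (let a = corner m; b = 1 / real m in
      {x \<in> {1..d} \<rightarrow>\<^sub>E UNIV.
         (x 1, x 2) \<in> convex hull {(a 1, a 2), (a 1 + 2 * b, a 2), (a 1, a 2 + b)} \<and>
         (\<forall>i\<in>{3..d}. x i \<in> {a i .. a i + b})})"

text \<open>
  The closure is taken in the product topology on \<^typ>\<open>nat \<Rightarrow> real\<close>. Extensional functions are
  constant outside \<open>{1..d}\<close> and form a closed set, so this is the closure in $\mathbb{R}^d$.
\<close>

definition Omega2_star :: "nat \<Rightarrow> nat \<Rightarrow> (nat \<Rightarrow> real) set" where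
  "Omega2_star d m = closure (merged_box d m - Omega1_star d m)"

text \<open>
  The cubes $Q_3, \dots, Q_N$ come in no particular order, so every enumeration of the grid
  cubes outside the merged box is admitted.
\<close>

definition is_Omega_star :: "nat \<Rightarrow> nat \<Rightarrow> (nat \<Rightarrow> (nat \<Rightarrow> real) set) \<Rightarrow> bool" where
  "is_Omega_star d m \<Omega> \<longleftrightarrow>
     \<Omega> 1 = Omega1_star d m \<and> \<Omega> 2 = Omega2_star d m \<and>
     bij_betw \<Omega> {3..m ^ d} {Q \<in> grid_cubes d m. \<not> Q \<subseteq> merged_box d m}"

text \<open>
  The last branch uses \<^const>\<open>cot\<close>, which is 0 at \<open>pi / 2\<close> as required. Only the values on
  \<open>{0..pi / 2}\<close> are meaningful.
\<close>

definition P_fun :: "real \<Rightarrow> real" where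
  "P_fun \<theta> =
     (if \<theta> < arctan (1 / 2) then 2 / 45 * tan \<theta> ^ 3 + 2 / 15 * tan \<theta> ^ 2 - tan \<theta> / 6
      else if \<theta> = arctan (1 / 2) then - (2 / 45)
      else - (1 / 24) * cot \<theta> + 1 / 120 * cot \<theta> ^ 2 + 1 / 1440 * cot \<theta> ^ 3)"

end

theory Submission
  imports Defs
begin

text \<open>
  Fix the corner \<open>z\<close> of the test box $[0,z)$ and let $q_i(z)$ be the probability that the \<open>i\<close>-th point
  falls into it. All cells have volume $1/N$ and fill the unit cube, so the average of the
  indicators is an unbiased estimator of the volume of the box, and independence of the points
  gives
  $$\mathbb{E}\,L_2^2 = \frac{1}{N^2} \int_{[0,1]^d} \sum_{i=1}^N q_i(z) (1 - q_i(z))\,dz$$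
  (lemma \<open>expected_L2_discrepancy_sq_equivolume\<close>).

  The sum of variances can be bounded uniformly in \<open>z\<close>. A grid cube contributes only if it is cut
  by the boundary of $[0,z)$, which restricts it to one of \<open>d\<close> slabs of $m^{d-1}$ cubes
  (lemma \<open>sum_grid_cube_variances_le\<close>), and every contribution is at most $1/4$. Together with the
  two halves of the merged box this gives
  $$\mathbb{E}\,L_2^2 \<le> \frac{1}{N^2} \Big(\frac{d\,m^{d-1}}{4} + \frac12\Big).$$
  The main term of the asserted bound is $d / N^{1+1/d} = d\,m^{d-1} / N^2$ with $d\,m^{d-1} \<ge> 4$. The
  factor $1/4$ therefore leaves a gap of at least $3/N^2$, which covers $1/(2N^2)$ and the negative
  correction of size at most $2/(45 N^3)$ at once.

  The geometric part consists in showing that the modified partition has cells of equal volume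
  that fill every test box up to null sets. Both halves of the merged box are its intersections with
  the closed half-spaces on either side of the hyperplane $x_1 + 2 x_2 = 3 - 2/m$
  (lemmas \<open>Omega1_star_eq\<close> and \<open>Omega2_star_eq\<close>), and the volume of the first half is computed from
  its sections. Optimality within the family of bounds is the inequality $P(\theta) \<ge> -2/45$, which
  follows from explicit factorizations of $P + 2/45$ (lemma \<open>P_fun_ge\<close>).
\<close>

section \<open>Volumes of product sets\<close>

lemma product_sigma_finite_lborel: "product_sigma_finite (\<lambda>_::nat. lborel :: real measure)"
  by standard

lemma sigma_finite_leb: "sigma_finite_measure (leb d)"
  unfolding leb_def
  by (rule product_sigma_finite.sigma_finite[OF product_sigma_finite_lborel]) simp

lemma space_leb: "space (leb d) = {1..d} \<rightarrow>\<^sub>E UNIV"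
  by (simp add: leb_def space_PiM)

lemma measurable_leb_component: "i \<in> {1..d} \<Longrightarrow> (\<lambda>x. x i) \<in> borel_measurable (leb d)"
  unfolding leb_def by simp

lemma PiE_in_sets_leb:
  assumes "\<And>i. i \<in> {1..d} \<Longrightarrow> S i \<in> sets borel"
  shows "(\<Pi>\<^sub>E i\<in>{1..d}. S i) \<in> sets (leb d)"
  unfolding leb_def using assms by (intro sets_PiM_I_finite) auto

lemma emeasure_leb_PiE:
  assumes "\<And>i. i \<in> {1..d} \<Longrightarrow> S i \<in> sets borel"
  shows "emeasure (leb d) (\<Pi>\<^sub>E i\<in>{1..d}. S i) = (\<Prod>i=1..d. emeasure lborel (S i))"
  unfolding leb_def using assms
  by (intro product_sigma_finite.emeasure_PiM[OF product_sigma_finite_lborel]) auto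

lemma measure_leb_PiE:
  assumes "\<And>i. i \<in> {1..d} \<Longrightarrow> S i \<in> sets borel"
  shows "measure (leb d) (\<Pi>\<^sub>E i\<in>{1..d}. S i) = (\<Prod>i=1..d. measure lborel (S i))"
proof -
  have "emeasure (leb d) (\<Pi>\<^sub>E i\<in>{1..d}. S i) = (\<Prod>i=1..d. emeasure lborel (S i))"
    by (rule emeasure_leb_PiE) (rule assms)
  moreover have "enn2real (\<Prod>i\<in>J. emeasure lborel (S i)) = (\<Prod>i\<in>J. enn2real (emeasure lborel (S i)))"
    if "finite J" for J
    using that by (induction J) (auto simp: enn2real_mult)
  ultimately show ?thesis
    by (simp add: measure_def)
qed

lemma anchored_box_in_sets: "anchored_box d z \<in> sets (leb d)"
  unfolding anchored_box_def by (rule PiE_in_sets_leb) auto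

lemma unit_cube_in_sets: "unit_cube d \<in> sets (leb d)"
  unfolding unit_cube_def by (rule PiE_in_sets_leb) auto

lemma emeasure_unit_cube: "emeasure (leb d) (unit_cube d) = 1"
  unfolding unit_cube_def by (subst emeasure_leb_PiE) auto

lemma measure_anchored_box: "measure (leb d) (anchored_box d z) = (\<Prod>i=1..d. max 0 (z i))"
  unfolding anchored_box_def
proof (subst measure_leb_PiE)
  have "measure lborel {0..<z i} = max 0 (z i)" for i
    by (cases "0 \<le> z i") auto
  then show "(\<Prod>i=1..d. measure lborel {0..<z i}) = (\<Prod>i=1..d. max 0 (z i))"
    by simp
qed auto

section \<open>Expected discrepancy as an integrated variance\<close>

text \<open>
  Each summand has mean zero, and distinct coordinates of the product space are independent, so
  all mixed products vanish and only the Bernoulli variances $p(1 - p)$ remain.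
\<close>

lemma (in product_prob_space) variance_sum_centred_indicators:
  assumes I: "finite J" and A: "\<And>i. i \<in> J \<Longrightarrow> A i \<in> sets (M i)"
  shows "(LINT t|PiM J M. (\<Sum>i\<in>J. measure (M i) (A i) - indicator (A i) (t i))\<^sup>2)
           = (\<Sum>i\<in>J. measure (M i) (A i) * (1 - measure (M i) (A i)))"
proof -
  interpret J: prob_space "PiM J M" by (rule prob_space_PiM) (rule prob_space)
  define p where "p i = measure (M i) (A i)" for i
  define c :: "'i \<Rightarrow> 'a \<Rightarrow> real" where "c i x = p i - indicator (A i) x" for i x
  have c_int: "integrable (M i) (c i)" and c0: "integral\<^sup>L (M i) (c i) = 0"
    and c2_int: "integrable (M i) (\<lambda>x. (c i x)\<^sup>2)"
    and c2: "(LINT x|M i. (c i x)\<^sup>2) = p i * (1 - p i)" if "i \<in> J" for i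
  proof -
    interpret Mi: prob_space "M i" by (rule prob_space)
    have [measurable]: "A i \<in> sets (M i)" using A that by simp
    have 1: "integrable (M i) (indicator (A i) :: 'a \<Rightarrow> real)"
      by (simp add: integrable_indicator_iff less_top[symmetric])
    show "integrable (M i) (c i)" unfolding c_def using 1 by auto
    show "integral\<^sup>L (M i) (c i) = 0"
      unfolding c_def using 1 by (simp add: p_def M.prob_space)
    have eq: "(c i x)\<^sup>2 = p i ^ 2 + (1 - 2 * p i) * indicator (A i) x" for x
      by (auto simp: c_def indicator_def power2_eq_square algebra_simps)
    show "integrable (M i) (\<lambda>x. (c i x)\<^sup>2)"
      unfolding eq using 1 by auto
    show "(LINT x|M i. (c i x)\<^sup>2) = p i * (1 - p i)"
      unfolding eq using 1 by (simp add: p_def[symmetric] M.prob_space)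
        (simp add: power2_eq_square algebra_simps)
  qed
  have int1: "integrable (M k) (\<lambda>x. 1 :: real)" for k
    using prob_space[of k] by (simp add: prob_space.emeasure_space_1 integrable_iff_bounded)
  have cc: "integrable (PiM J M) (\<lambda>t. c i (t i) * c j (t j)) \<and>
      (LINT t|PiM J M. c i (t i) * c j (t j)) = (if i = j then p i * (1 - p i) else 0)"
    if ij: "i \<in> J" "j \<in> J" for i j
  proof (cases "i = j")
    case True
    \<comment> \<open>The integrand depends on one coordinate; constant factors 1 turn it into a full product.\<close>
    define g where "g k = (if k = i then (\<lambda>x. (c i x)\<^sup>2) else (\<lambda>_. 1))" for k
    have gi: "integrable (M k) (g k)" if "k \<in> J" for k
      using c2_int that int1 unfolding g_def by (cases "k = i") auto
    have g: "c i (t i) * c j (t j) = (\<Prod>k\<in>J. g k (t k))" for t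
    proof -
      have "(\<Prod>k\<in>J. g k (t k)) = (\<Prod>k\<in>J. if k = i then (c i (t i))\<^sup>2 else 1)"
        by (intro prod.cong) (auto simp: g_def)
      then show ?thesis using True ij I by (simp add: prod.delta power2_eq_square)
    qed
    have "(\<Prod>k\<in>J. integral\<^sup>L (M k) (g k)) = (\<Prod>k\<in>J. if k = i then p i * (1 - p i) else 1)"
      using c2 ij prob_space by (intro prod.cong) (auto simp: g_def prob_space.prob_space)
    then show ?thesis
      unfolding g using product_integrable_prod[OF I gi] product_integral_prod[OF I gi] True ij I
      by (simp add: prod.delta)
  next
    case False
    define g where "g k = (if k \<in> {i, j} then c k else (\<lambda>_. 1))" for k
    have gi: "integrable (M k) (g k)" if "k \<in> J" for k
      using c_int that int1 unfolding g_def by auto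
    have g: "c i (t i) * c j (t j) = (\<Prod>k\<in>J. g k (t k))" for t
    proof -
      have "(\<Prod>k\<in>J. g k (t k)) = (\<Prod>k\<in>{i, j}. g k (t k))"
        using ij I by (intro prod.mono_neutral_right) (auto simp: g_def)
      then show ?thesis using False by (simp add: g_def)
    qed
    have "(\<Prod>k\<in>J. integral\<^sup>L (M k) (g k)) = 0"
      using I ij c0[of i] by (intro prod_zero) (auto simp: g_def intro!: bexI[of _ i])
    then show ?thesis
      unfolding g using product_integrable_prod[OF I gi] product_integral_prod[OF I gi] False
      by simp
  qed
  have "(LINT t|PiM J M. (\<Sum>i\<in>J. c i (t i))\<^sup>2) = (LINT t|PiM J M. (\<Sum>i\<in>J. \<Sum>j\<in>J. c i (t i) * c j (t j)))"
    by (simp add: power2_eq_square sum_product)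
  also have "\<dots> = (\<Sum>i\<in>J. \<Sum>j\<in>J. LINT t|PiM J M. c i (t i) * c j (t j))"
    using cc by (simp add: Bochner_Integration.integral_sum)
  also have "\<dots> = (\<Sum>i\<in>J. \<Sum>j\<in>J. if i = j then p i * (1 - p i) else 0)"
    using cc by (intro sum.cong) auto
  also have "\<dots> = (\<Sum>i\<in>J. p i * (1 - p i))"
    using I by (simp add: sum.delta)
  finally show ?thesis by (simp add: c_def p_def)
qed

text \<open>
  For a fixed corner \<open>z\<close> the number of points in the box $[0,z)$ is a sum of independent Bernoulli
  variables with parameters \<open>q i z\<close>. Because every cell has volume $1/N$ and the cells fill the box,
  the mean of the counting average is exactly the volume of the box, so the expected square of the
  local discrepancy is a variance. Fubini's theorem carries this over to the integral in \<open>z\<close>.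
\<close>

lemma expected_L2_discrepancy_sq_equivolume:
  assumes N: "N \<ge> 1"
    and meas: "\<And>i. i \<in> {1..N} \<Longrightarrow> \<Omega> i \<in> sets (leb d)"
    and vol: "\<And>i. i \<in> {1..N} \<Longrightarrow> emeasure (leb d) (\<Omega> i) = ennreal (1 / real N)"
    and part: "\<And>z. z \<in> unit_cube d \<Longrightarrow>
      (\<Sum>i=1..N. measure (leb d) (\<Omega> i \<inter> anchored_box d z)) = measure (leb d) (anchored_box d z)"
  defines "q \<equiv> \<lambda>i z. real N * measure (leb d) (\<Omega> i \<inter> anchored_box d z)"
  shows "expected_L2_discrepancy_sq d N \<Omega>
           = (LINT z:unit_cube d|leb d. (\<Sum>i=1..N. q i z * (1 - q i z))) / real N ^ 2"
proof -
  \<comment> \<open>The locale asks for a probability measure at every index; outside \<open>{1..N}\<close> the uniform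
     distribution on the unit cube serves as a placeholder.\<close>
  define M where "M i = uniform_measure (leb d) (if i \<in> {1..N} then \<Omega> i else unit_cube d)" for i
  have M_eq: "i \<in> {1..N} \<Longrightarrow> M i = uniform_measure (leb d) (\<Omega> i)" for i
    by (simp add: M_def)
  have prob_M: "prob_space (M i)" for i
    unfolding M_def using vol N emeasure_unit_cube
    by (intro prob_space_uniform_measure) (auto split: if_splits)
  interpret product_prob_space M
    by (intro product_prob_space.intro product_sigma_finite.intro product_prob_space_axioms.intro
        prob_M prob_space_imp_sigma_finite)
  define J where "J = {1..N}"
  have J: "finite J" "card J = N" by (auto simp: J_def)
  define L where "L = PiM J M"
  have law: "stratified_law d N \<Omega> = L"
    unfolding stratified_law_def L_def J_def using M_eq by (intro PiM_cong) auto
  interpret L: prob_space L unfolding L_def by (rule prob_space_PiM) (rule prob_M)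
  interpret leb: sigma_finite_measure "leb d" by (rule sigma_finite_leb)
  interpret pair_sigma_finite L "leb d" by standard

  have sets_M: "sets (M i) = sets (leb d)" "space (M i) = space (leb d)" for i
    by (auto simp: M_def)
  have p: "measure (M i) (anchored_box d z) = q i z" if "i \<in> J" for i z
  proof -
    have "measure (leb d) (\<Omega> i) = 1 / real N"
      using vol that by (simp add: J_def measure_def)
    then show ?thesis
      using that vol N anchored_box_in_sets[of d z]
      by (simp add: M_eq J_def q_def)
  qed

  define e :: "(nat \<Rightarrow> nat \<Rightarrow> real) \<Rightarrow> (nat \<Rightarrow> real) \<Rightarrow> real" where
    "e t z = measure (leb d) (anchored_box d z)
         - (1 / real N) * (\<Sum>i=1..N. indicator (anchored_box d z) (t i))" for t z
  define f :: "(nat \<Rightarrow> nat \<Rightarrow> real) \<Rightarrow> (nat \<Rightarrow> real) \<Rightarrow> real" where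
    "f t z = indicator (unit_cube d) z * (e t z)\<^sup>2" for t z
  have ind: "indicator (anchored_box d z) (t i)
      = (\<Prod>j=1..d. if 0 \<le> t i j \<and> t i j < z j then 1 else 0 :: real)"
    if t: "t \<in> space L" and i: "i \<in> {1..N}" for t z i
  proof -
    have "t i \<in> space (leb d)"
      using t i sets_M by (auto simp: L_def J_def space_PiM)
    then have "t i \<in> anchored_box d z \<longleftrightarrow> (\<forall>j\<in>{1..d}. 0 \<le> t i j \<and> t i j < z j)"
      by (auto simp: anchored_box_def space_leb PiE_iff)
    then show ?thesis
      by (cases "\<forall>j\<in>{1..d}. 0 \<le> t i j \<and> t i j < z j") (auto simp: indicator_def)
  qed
  have comp1[measurable]: "(\<lambda>w. fst w i j) \<in> borel_measurable (L \<Otimes>\<^sub>M leb d)"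
    if "i \<in> {1..N}" "j \<in> {1..d}" for i j
  proof -
    have "(\<lambda>t. t i) \<in> measurable L (M i)"
      unfolding L_def J_def using that by (intro measurable_component_singleton)
    then have "(\<lambda>t. t i) \<in> measurable L (leb d)"
      using measurable_cong_sets[OF refl sets_M(1)] by blast
    from measurable_compose[OF measurable_compose[OF measurable_fst this]
        measurable_leb_component[OF that(2)]]
    show ?thesis .
  qed
  have comp2[measurable]: "(\<lambda>w. snd w j) \<in> borel_measurable (L \<Otimes>\<^sub>M leb d)" if "j \<in> {1..d}" for j
    by (rule measurable_compose[OF measurable_snd measurable_leb_component[OF that]])
  have f_meas: "(\<lambda>w. f (fst w) (snd w)) \<in> borel_measurable (L \<Otimes>\<^sub>M leb d)"
  proof -
    note unit_cube_in_sets[measurable]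
    have "(\<lambda>w. indicator (unit_cube d) (snd w) * ((\<Prod>j=1..d. max 0 (snd w j))
        - (1 / real N) * (\<Sum>i=1..N. \<Prod>j=1..d. if 0 \<le> fst w i j \<and> fst w i j < snd w j then 1 else 0))\<^sup>2 :: real)
      \<in> borel_measurable (L \<Otimes>\<^sub>M leb d)"
      by measurable
    then show ?thesis
      by (rule measurable_cong[THEN iffD1, rotated])
         (auto simp: f_def e_def measure_anchored_box ind space_pair_measure)
  qed
  have e_le: "\<bar>e t z\<bar> \<le> 1" if "z \<in> unit_cube d" for t z
  proof -
    have z: "0 \<le> z i" "z i \<le> 1" if "i \<in> {1..d}" for i
      using \<open>z \<in> unit_cube d\<close> that unfolding unit_cube_def by (metis PiE_mem atLeastAtMost_iff)+
    have V: "0 \<le> (\<Prod>j=1..d. max 0 (z j))" "(\<Prod>j=1..d. max 0 (z j)) \<le> 1"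
      using z by (auto intro!: prod_nonneg prod_le_1)
    have S: "0 \<le> (\<Sum>i=1..N. indicator (anchored_box d z) (t i) :: real)"
      by (intro sum_nonneg) auto
    have "(\<Sum>i=1..N. indicator (anchored_box d z) (t i) :: real) \<le> (\<Sum>i=1..N. 1)"
      by (intro sum_mono) (auto simp: indicator_def)
    then have "(1 / real N) * (\<Sum>i=1..N. indicator (anchored_box d z) (t i)) \<le> 1"
      using N by (simp add: field_simps)
    moreover have "0 \<le> (1 / real N) * (\<Sum>i=1..N. indicator (anchored_box d z) (t i))"
      using S by simp
    ultimately show ?thesis using V unfolding e_def measure_anchored_box by linarith
  qed
  have f_int: "integrable (L \<Otimes>\<^sub>M leb d) (case_prod f)"
  proof (rule integrableI_bounded_set[where A = "space L \<times> unit_cube d" and B = 1])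
    show "space L \<times> unit_cube d \<in> sets (L \<Otimes>\<^sub>M leb d)"
      using unit_cube_in_sets by (intro pair_measureI) auto
    show "case_prod f \<in> borel_measurable (L \<Otimes>\<^sub>M leb d)"
      using f_meas by (simp add: case_prod_beta')
    show "emeasure (L \<Otimes>\<^sub>M leb d) (space L \<times> unit_cube d) < \<infinity>"
      using unit_cube_in_sets
      by (subst leb.emeasure_pair_measure_Times) (auto simp: L.emeasure_space_1 emeasure_unit_cube)
    have "norm (f t z) \<le> 1" if "z \<in> unit_cube d" for t z
      using power_mono[OF e_le[OF that, of t], of 2] that by (simp add: f_def)
    then show "AE x in L \<Otimes>\<^sub>M leb d. x \<in> space L \<times> unit_cube d \<longrightarrow> norm (case_prod f x) \<le> 1"
      by auto
    show "AE x in L \<Otimes>\<^sub>M leb d. x \<notin> space L \<times> unit_cube d \<longrightarrow> case_prod f x = 0"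
      by (rule AE_I2) (auto simp: f_def space_pair_measure indicator_eq_0_iff)
  qed

  have sq: "(L2_discrepancy d N t)\<^sup>2 = (LINT z|leb d. f t z)" for t
  proof -
    have "L2_discrepancy d N t = sqrt (LINT z|leb d. f t z)"
      unfolding L2_discrepancy_def set_lebesgue_integral_def f_def e_def by simp
    moreover have "0 \<le> (LINT z|leb d. f t z)"
      by (intro Bochner_Integration.integral_nonneg) (simp add: f_def)
    ultimately show ?thesis by simp
  qed
  have inner: "(LINT t|L. f t z) = indicator (unit_cube d) z * (\<Sum>i\<in>J. q i z * (1 - q i z)) / real N ^ 2"
    for z
  proof (cases "z \<in> unit_cube d")
    case True
    have "e t z = (1 / real N) * (\<Sum>i\<in>J. measure (M i) (anchored_box d z) - indicator (anchored_box d z) (t i))" for t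
    proof -
      have "(\<Sum>i\<in>J. measure (M i) (anchored_box d z)) = real N * measure (leb d) (anchored_box d z)"
        unfolding part[OF True, symmetric] sum_distrib_left J_def[symmetric]
        using p by (intro sum.cong) (auto simp: q_def)
      then show ?thesis
        using N by (simp add: e_def J_def sum_subtractf right_diff_distrib)
    qed
    then have "(LINT t|L. f t z)
        = (1 / real N)\<^sup>2 * (LINT t|L. (\<Sum>i\<in>J. measure (M i) (anchored_box d z) - indicator (anchored_box d z) (t i))\<^sup>2)"
      using True by (simp add: f_def power_mult_distrib power_divide)
    also have "(LINT t|L. (\<Sum>i\<in>J. measure (M i) (anchored_box d z) - indicator (anchored_box d z) (t i))\<^sup>2)
        = (\<Sum>i\<in>J. q i z * (1 - q i z))"
      unfolding L_def using anchored_box_in_sets p J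
      by (subst variance_sum_centred_indicators) (auto simp: sets_M)
    finally show ?thesis using True by (simp add: power_divide)
  qed (simp add: f_def)
  have "expected_L2_discrepancy_sq d N \<Omega> = (LINT t|L. LINT z|leb d. f t z)"
    unfolding expected_L2_discrepancy_sq_def law sq ..
  also have "\<dots> = (LINT z|leb d. LINT t|L. f t z)"
    using Fubini_integral[OF f_int] by simp
  also have "\<dots> = (LINT z:unit_cube d|leb d. (\<Sum>i=1..N. q i z * (1 - q i z))) / real N ^ 2"
    unfolding inner set_lebesgue_integral_def J_def by simp
  finally show ?thesis .
qed

text \<open>
  The unit cube has volume 1, so a bound on the sum of variances that is uniform in \<open>z\<close> survives the
  integration.
\<close>

lemma expected_L2_discrepancy_sq_le:
  assumes "N \<ge> 1"
    and "\<And>i. i \<in> {1..N} \<Longrightarrow> \<Omega> i \<in> sets (leb d)"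
    and "\<And>i. i \<in> {1..N} \<Longrightarrow> emeasure (leb d) (\<Omega> i) = ennreal (1 / real N)"
    and "\<And>z. z \<in> unit_cube d \<Longrightarrow>
      (\<Sum>i=1..N. measure (leb d) (\<Omega> i \<inter> anchored_box d z)) = measure (leb d) (anchored_box d z)"
  defines "q \<equiv> \<lambda>i z. real N * measure (leb d) (\<Omega> i \<inter> anchored_box d z)"
  assumes bound: "\<And>z. z \<in> unit_cube d \<Longrightarrow> (\<Sum>i=1..N. q i z * (1 - q i z)) \<le> C"
    and "0 \<le> C"
  shows "expected_L2_discrepancy_sq d N \<Omega> \<le> C / real N ^ 2"
proof -
  have cube: "emeasure (leb d) (unit_cube d) < \<infinity>" by (simp add: emeasure_unit_cube)
  have C_int: "set_integrable (leb d) (unit_cube d) (\<lambda>_. C)"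
    using cube unit_cube_in_sets by (simp add: set_integrable_def)
  have C: "(LINT z:unit_cube d|leb d. C) = C"
    using emeasure_unit_cube unit_cube_in_sets by (simp add: set_integral_const cube measure_def)
  have "(LINT z:unit_cube d|leb d. (\<Sum>i=1..N. q i z * (1 - q i z))) \<le> (LINT z:unit_cube d|leb d. C)"
  proof (cases "set_integrable (leb d) (unit_cube d) (\<lambda>z. \<Sum>i=1..N. q i z * (1 - q i z))")
    case True
    then show ?thesis using C_int bound by (intro set_integral_mono) auto
  next
    case False
    then show ?thesis
      using C \<open>0 \<le> C\<close> by (simp add: set_integrable_def set_lebesgue_integral_def not_integrable_integral_eq)
  qed
  then show ?thesis
    using expected_L2_discrepancy_sq_equivolume[of N \<Omega> d] assms(1-4)
    unfolding q_def C by (simp add: divide_right_mono)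
qed

section \<open>The regular grid\<close>

definition grid_cell :: "nat \<Rightarrow> nat \<Rightarrow> real set" where
  "grid_cell m j = {real j / real m .. (real j + 1) / real m}"

definition grid_cube :: "nat \<Rightarrow> nat \<Rightarrow> (nat \<Rightarrow> nat) \<Rightarrow> (nat \<Rightarrow> real) set" where
  "grid_cube d m k = (\<Pi>\<^sub>E i\<in>{1..d}. grid_cell m (k i))"

abbreviation grid_indices :: "nat \<Rightarrow> nat \<Rightarrow> (nat \<Rightarrow> nat) set" where
  "grid_indices d m \<equiv> {1..d} \<rightarrow>\<^sub>E {0..<m}"

lemma grid_cubes_eq: "grid_cubes d m = grid_cube d m ` grid_indices d m"
  by (auto simp: grid_cubes_def grid_cube_def grid_cell_def image_def)

text \<open>
  The difference of minima also covers the degenerate cases of an empty or a full intersection,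
  and it makes the sum over all cells telescope.
\<close>

lemma measure_grid_cell_Int:
  assumes "0 < m" "0 \<le> s"
  shows "measure lborel (grid_cell m j \<inter> {0..<s})
           = min (real (Suc j) / real m) s - min (real j / real m) s"
proof -
  have lt: "real j / real m < (real j + 1) / real m" "0 \<le> real j / real m"
    using assms by (auto simp: divide_simps)
  consider "s \<le> real j / real m" | "real j / real m < s" "s \<le> (real j + 1) / real m"
    | "(real j + 1) / real m < s"
    by linarith
  then show ?thesis
  proof cases
    case 1
    then have "grid_cell m j \<inter> {0..<s} = {}"
      by (auto simp: grid_cell_def)
    then show ?thesis using 1 lt by (simp add: min_def add.commute)
  next
    case 2
    then have "grid_cell m j \<inter> {0..<s} = {real j / real m..<s}"
      using order_trans[OF lt(2)] lt(1) unfolding grid_cell_def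
      by (simp add: set_eq_iff) (meson less_le_trans le_less_trans less_imp_le order_trans)
    then show ?thesis using 2 lt by (simp add: min_def add.commute)
  next
    case 3
    then have "grid_cell m j \<inter> {0..<s} = {real j / real m..(real j + 1) / real m}"
      using order_trans[OF lt(2)] lt(1) unfolding grid_cell_def
      by (simp add: set_eq_iff) (meson less_le_trans le_less_trans less_imp_le order_trans)
    then show ?thesis using 3 lt by (simp add: min_def add.commute)
  qed
qed

lemma sum_measure_grid_cell_Int:
  assumes "0 < m" "0 \<le> s" "s \<le> 1"
  shows "(\<Sum>j\<in>{0..<m}. measure lborel (grid_cell m j \<inter> {0..<s})) = s"
proof -
  have "(\<Sum>j\<in>{0..<m}. measure lborel (grid_cell m j \<inter> {0..<s}))
      = (\<Sum>j\<in>{0..<m}. min (real (Suc j) / real m) s - min (real j / real m) s)"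
    using assms by (intro sum.cong) (auto simp: measure_grid_cell_Int)
  also have "\<dots> = min (real m / real m) s - min (real 0 / real m) s"
    by (rule sum_Suc_diff') simp
  also have "\<dots> = s" using assms by simp
  finally show ?thesis .
qed

text \<open>
  Only the cell that contains \<open>s\<close> can be cut by the end point of $[0,s)$; all others lie inside or
  outside. For $s = 1$ the floor is \<open>m\<close>, which is the index of no cell of the unit interval.
\<close>

lemma measure_grid_cell_Int_not_cut:
  assumes "0 < m" "0 \<le> s" "int j \<noteq> \<lfloor>real m * s\<rfloor>"
  shows "real m * measure lborel (grid_cell m j \<inter> {0..<s}) \<in> {0, 1}"
proof -
  have "real m * s < real j \<or> real j + 1 \<le> real m * s"
    using assms(3) by linarith
  then have "s < real j / real m \<or> (real j + 1) / real m \<le> s"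
    using assms(1) by (auto simp: field_simps)
  moreover have "real j / real m < (real j + 1) / real m"
    using assms by (auto simp: divide_simps)
  ultimately show ?thesis
    using assms by (auto simp: measure_grid_cell_Int min_def add.commute field_simps)
qed

lemma grid_cube_in_sets: "grid_cube d m k \<in> sets (leb d)"
  unfolding grid_cube_def grid_cell_def by (rule PiE_in_sets_leb) auto

lemma PiE_Int_anchored_box:
  "(\<Pi>\<^sub>E i\<in>{1..d}. S i) \<inter> anchored_box d z = (\<Pi>\<^sub>E i\<in>{1..d}. S i \<inter> {0..<z i})"
  by (simp add: anchored_box_def PiE_Int)

lemma measure_grid_cube_Int:
  "measure (leb d) (grid_cube d m k \<inter> anchored_box d z)
     = (\<Prod>i=1..d. measure lborel (grid_cell m (k i) \<inter> {0..<z i}))"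
  unfolding grid_cube_def PiE_Int_anchored_box
  by (rule measure_leb_PiE) (auto simp: grid_cell_def)

lemma emeasure_grid_cube:
  assumes "0 < m"
  shows "emeasure (leb d) (grid_cube d m k) = ennreal (1 / real (m ^ d))"
proof -
  have "emeasure lborel (grid_cell m j) = ennreal (1 / real m)" for j
    using assms unfolding grid_cell_def
    by (subst emeasure_lborel_Icc) (auto simp: divide_simps)
  then have "emeasure (leb d) (grid_cube d m k) = (\<Prod>i=1..d. ennreal (1 / real m))"
    unfolding grid_cube_def by (subst emeasure_leb_PiE) (auto simp: grid_cell_def)
  then show ?thesis
    by (simp add: ennreal_power power_divide)
qed

lemma unit_cubeD: "z \<in> unit_cube d \<Longrightarrow> i \<in> {1..d} \<Longrightarrow> 0 \<le> z i \<and> z i \<le> 1"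
  unfolding unit_cube_def by (metis PiE_mem atLeastAtMost_iff)

lemma sum_measure_grid_cube_Int:
  assumes "0 < m" "z \<in> unit_cube d"
  shows "(\<Sum>k\<in>grid_indices d m. measure (leb d) (grid_cube d m k \<inter> anchored_box d z))
           = measure (leb d) (anchored_box d z)"
proof -
  have "(\<Sum>k\<in>grid_indices d m. measure (leb d) (grid_cube d m k \<inter> anchored_box d z))
      = (\<Prod>i=1..d. \<Sum>j\<in>{0..<m}. measure lborel (grid_cell m j \<inter> {0..<z i}))"
    unfolding measure_grid_cube_Int by (subst prod_sum_PiE) auto
  also have "\<dots> = (\<Prod>i=1..d. max 0 (z i))"
    using assms unit_cubeD[OF assms(2)]
    by (intro prod.cong) (auto simp: sum_measure_grid_cell_Int max_def)
  finally show ?thesis by (simp add: measure_anchored_box)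
qed

lemma mult_one_minus_le_quarter: "x * (1 - x) \<le> 1 / 4" for x :: real
proof -
  have "0 \<le> (x - 1 / 2)\<^sup>2" by simp
  then show ?thesis by (simp add: power2_eq_square algebra_simps)
qed

text \<open>
  A cube contributes only if the boundary of $[0,z)$ cuts it. Such a cube has, in some coordinate
  \<open>i\<close>, the index $\lfloor m z_i \rfloor$, hence lies in one of \<open>d\<close> slabs of at most $m^{d-1}$ cubes each,
  and a Bernoulli variance is at most $1/4$.
\<close>

lemma sum_grid_cube_variances_le:
  assumes "0 < m" "z \<in> unit_cube d" "K \<subseteq> grid_indices d m"
  defines "q \<equiv> \<lambda>k. real (m ^ d) * measure (leb d) (grid_cube d m k \<inter> anchored_box d z)"
  shows "(\<Sum>k\<in>K. q k * (1 - q k)) \<le> real d * real m ^ (d - 1) / 4"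
proof -
  \<comment> \<open>The only index in direction \<open>i\<close> whose cell the face $x_i = z_i$ can cut.\<close>
  define c where "c i = nat \<lfloor>real m * z i\<rfloor>" for i
  define slab where "slab i = {k \<in> grid_indices d m. k i = c i}" for i
  have fin: "finite (grid_indices d m)"
    by (intro finite_PiE) auto
  have finK: "finite K" using fin assms(3) by (rule rev_finite_subset)
  have zero: "q k * (1 - q k) = 0" if k: "k \<in> K" "k \<notin> (\<Union>i\<in>{1..d}. slab i)" for k
  proof -
    have factor: "real m * measure lborel (grid_cell m (k i) \<inter> {0..<z i}) \<in> {0, 1}" if i: "i \<in> {1..d}" for i
    proof (rule measure_grid_cell_Int_not_cut)
      show "0 \<le> z i" using unit_cubeD[OF assms(2) i] by simp
      have "k i \<noteq> c i" using k assms(3) i by (auto simp: slab_def)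
      then show "int (k i) \<noteq> \<lfloor>real m * z i\<rfloor>" by (auto simp: c_def)
    qed fact
    have prod01: "(\<Prod>i\<in>I. f i) \<in> {0, 1}" if "\<And>i. i \<in> I \<Longrightarrow> f i \<in> {0, 1}" for I and f :: "nat \<Rightarrow> real"
      using that
    proof (induction I rule: infinite_finite_induct)
      case (insert x F)
      then have "f x \<in> {0, 1}" "prod f F \<in> {0, 1}" by blast+
      then show ?case using insert.hyps by auto
    qed auto
    have "(\<Prod>i=1..d. real m * measure lborel (grid_cell m (k i) \<inter> {0..<z i})) \<in> {0, 1}"
      by (rule prod01) (rule factor)
    moreover have "(\<Prod>i=1..d. real m * measure lborel (grid_cell m (k i) \<inter> {0..<z i})) = q k"
      by (simp add: q_def measure_grid_cube_Int prod.distrib)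
    ultimately have "q k \<in> {0, 1}" by (simp only:)
    then show ?thesis by auto
  qed
  have slab_card: "card (slab i) \<le> m ^ (d - 1)" if i: "i \<in> {1..d}" for i
  proof -
    have "slab i \<subseteq> (\<Pi>\<^sub>E l\<in>{1..d}. if l = i then {c i} else {0..<m})"
      by (auto simp: slab_def PiE_iff extensional_def)
    then have "card (slab i) \<le> card (\<Pi>\<^sub>E l\<in>{1..d}. if l = i then {c i} else {0..<m})"
      by (intro card_mono finite_PiE) auto
    also have "\<dots> = (\<Prod>l\<in>{1..d}. if l = i then 1 else m)"
      by (subst card_PiE) (auto intro!: prod.cong)
    also have "\<dots> = m ^ (d - 1)"
      using i by (subst prod.remove[of _ i]) auto
    finally show ?thesis .
  qed
  have "(\<Sum>k\<in>K. q k * (1 - q k)) = (\<Sum>k\<in>K \<inter> (\<Union>i\<in>{1..d}. slab i). q k * (1 - q k))"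
    using finK zero by (intro sum.mono_neutral_right) auto
  also have "\<dots> \<le> (\<Sum>k\<in>K \<inter> (\<Union>i\<in>{1..d}. slab i). 1 / 4)"
    by (intro sum_mono mult_one_minus_le_quarter)
  also have "\<dots> \<le> (1 / 4) * real (card (\<Union>i\<in>{1..d}. slab i))"
    using fin by (auto intro!: card_mono simp: slab_def)
  also have "card (\<Union>i\<in>{1..d}. slab i) \<le> (\<Sum>i\<in>{1..d}. card (slab i))"
    by (rule card_UN_le) simp
  also have "(\<Sum>i\<in>{1..d}. card (slab i)) \<le> (\<Sum>i\<in>{1..d}. m ^ (d - 1))"
    by (intro sum_mono slab_card)
  finally show ?thesis by simp
qed

section \<open>The merged box and the cubes that it replaces\<close>

lemma merged_box_eq:
  assumes "0 < m"
  shows "merged_box d m = (\<Pi>\<^sub>E i\<in>{1..d}. {corner m i..1})"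
  unfolding merged_box_def using assms
  by (intro PiE_cong) (auto simp: corner_def field_simps)

lemma merged_box_in_sets: "merged_box d m \<in> sets (leb d)"
  unfolding merged_box_def by (rule PiE_in_sets_leb) auto

text \<open>The grid indices of the two cubes whose union is \<^const>\<open>merged_box\<close>.\<close>

definition lower_index :: "nat \<Rightarrow> nat \<Rightarrow> nat \<Rightarrow> nat" where
  "lower_index d m = (\<lambda>i\<in>{1..d}. if i = 1 then m - 2 else m - 1)"

definition upper_index :: "nat \<Rightarrow> nat \<Rightarrow> nat \<Rightarrow> nat" where
  "upper_index d m = (\<lambda>i\<in>{1..d}. m - 1)"

lemma lower_index_neq_upper_index:
  assumes "1 \<le> d" "2 \<le> m"
  shows "lower_index d m \<noteq> upper_index d m"
proof
  assume "lower_index d m = upper_index d m"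
  then have "lower_index d m 1 = upper_index d m 1" by (rule fun_cong)
  then show False using assms by (simp add: lower_index_def upper_index_def)
qed

text \<open>
  This identifies the two grid cubes that the partition replaces. Since the merged box lies at the
  far corner of the unit cube, the inclusion reduces to lower bounds for the indices.
\<close>

lemma grid_cube_subset_merged_box_iff:
  assumes "1 \<le> d" "2 \<le> m" "k \<in> grid_indices d m"
  shows "grid_cube d m k \<subseteq> merged_box d m \<longleftrightarrow> k \<in> {lower_index d m, upper_index d m}"
proof -
  have m: "0 < real m" using assms by simp
  have km: "k i < m" if "i \<in> {1..d}" for i using assms(3) that by auto
  have ne: "grid_cell m j \<noteq> {}" for j
    using m by (auto simp: grid_cell_def divide_simps)
  then have "grid_cube d m k \<subseteq> merged_box d m \<longleftrightarrow> (\<forall>i\<in>{1..d}. grid_cell m (k i) \<subseteq> {corner m i..1})"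
    using assms by (simp add: merged_box_eq grid_cube_def subset_PiE PiE_eq_empty_iff)
  also have "\<dots> \<longleftrightarrow> (\<forall>i\<in>{1..d}. corner m i \<le> real (k i) / real m)"
  proof (intro ball_cong refl)
    fix i assume i: "i \<in> {1..d}"
    have "(real (k i) + 1) / real m \<le> 1" using km[OF i] m by (simp add: field_simps)
    moreover have "real (k i) / real m \<le> (real (k i) + 1) / real m" using m by (simp add: divide_simps)
    ultimately show "grid_cell m (k i) \<subseteq> {corner m i..1} \<longleftrightarrow> corner m i \<le> real (k i) / real m"
      by (auto simp: grid_cell_def)
  qed
  also have "\<dots> \<longleftrightarrow> (\<forall>i\<in>{1..d}. (if i = 1 then m - 2 else m - 1) \<le> k i)"
  proof (intro ball_cong refl)
    fix i
    show "corner m i \<le> real (k i) / real m \<longleftrightarrow> (if i = 1 then m - 2 else m - 1) \<le> k i"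
      using assms m by (auto simp: corner_def divide_le_cancel)
  qed
  also have "\<dots> \<longleftrightarrow> k \<in> {lower_index d m, upper_index d m}"
  proof
    assume *: "\<forall>i\<in>{1..d}. (if i = 1 then m - 2 else m - 1) \<le> k i"
    have tail: "k i = m - 1" if "i \<in> {1..d}" "i \<noteq> 1" for i
      using *[rule_format, OF that(1)] km[OF that(1)] that by auto
    have "k 1 = m - 2 \<or> k 1 = m - 1"
      using *[rule_format, of 1] km[of 1] assms by auto
    then show "k \<in> {lower_index d m, upper_index d m}"
    proof
      assume "k 1 = m - 2"
      then have "k = lower_index d m"
        using assms(3) tail by (intro extensionalityI[where A = "{1..d}"]) (auto simp: lower_index_def PiE_iff)
      then show ?thesis by simp
    next
      assume "k 1 = m - 1"
      then have "k = upper_index d m"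
        using assms(3) tail by (intro extensionalityI[where A = "{1..d}"]) (auto simp: upper_index_def PiE_iff)
      then show ?thesis by simp
    qed
  next
    assume "k \<in> {lower_index d m, upper_index d m}"
    then show "\<forall>i\<in>{1..d}. (if i = 1 then m - 2 else m - 1) \<le> k i"
      by (auto simp: lower_index_def upper_index_def)
  qed
  finally show ?thesis .
qed

lemma prod_atLeast1_remove1:
  fixes f :: "nat \<Rightarrow> 'a::comm_monoid_mult"
  assumes "1 \<le> d"
  shows "(\<Prod>i=1..d. f i) = f 1 * (\<Prod>i=2..d. f i)"
  using assms prod.atLeast_Suc_atMost[of 1 d f] by (simp add: numeral_2_eq_2)

text \<open>
  The merged box and the two cubes are products that differ only in the first factor, where the
  interval of the merged box is the union of two adjacent cells with one common end point.
\<close>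

lemma measure_merged_box_Int:
  assumes "1 \<le> d" "2 \<le> m" "z \<in> unit_cube d"
  shows "measure (leb d) (merged_box d m \<inter> anchored_box d z)
           = measure (leb d) (grid_cube d m (lower_index d m) \<inter> anchored_box d z)
           + measure (leb d) (grid_cube d m (upper_index d m) \<inter> anchored_box d z)"
proof -
  have m: "0 < m" using assms by simp
  have r: "real (m - 1) = real m - 1" "real (m - 2) = real m - 2"
    using assms by auto
  have lo: "grid_cell m (m - 2) = {corner m 1..(real m - 1) / real m}"
    and hi: "grid_cell m (m - 1) = {(real m - 1) / real m..1}"
    using assms by (auto simp: grid_cell_def corner_def r)
  have ord: "corner m 1 < (real m - 1) / real m" "(real m - 1) / real m < 1"
    using assms by (auto simp: corner_def divide_simps)
  have z1: "0 \<le> z 1" using unit_cubeD[OF assms(3), of 1] assms(1) by simp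
  have head: "measure lborel ({corner m 1..1} \<inter> {0..<z 1})
      = measure lborel (grid_cell m (m - 2) \<inter> {0..<z 1}) + measure lborel (grid_cell m (m - 1) \<inter> {0..<z 1})"
  proof -
    have u: "{corner m 1..1} \<inter> {0..<z 1}
        = (grid_cell m (m - 2) \<inter> {0..<z 1}) \<union> (grid_cell m (m - 1) \<inter> {0..<z 1})"
      using ord unfolding lo hi by auto
    have fm: "S \<inter> {0..<z 1} \<in> fmeasurable lborel" if "S \<in> sets borel" for S
    proof (rule fmeasurableI2)
      show "{0..z 1} \<in> fmeasurable lborel" using z1 by (intro fmeasurableI) auto
    qed (use that in auto)
    have "measure lborel ((grid_cell m (m - 2) \<inter> {0..<z 1}) \<inter> (grid_cell m (m - 1) \<inter> {0..<z 1})) = 0"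
    proof -
      have "(grid_cell m (m - 2) \<inter> {0..<z 1}) \<inter> (grid_cell m (m - 1) \<inter> {0..<z 1}) \<subseteq> {(real m - 1) / real m}"
        unfolding lo hi by auto
      then consider "(grid_cell m (m - 2) \<inter> {0..<z 1}) \<inter> (grid_cell m (m - 1) \<inter> {0..<z 1}) = {}"
        | "(grid_cell m (m - 2) \<inter> {0..<z 1}) \<inter> (grid_cell m (m - 1) \<inter> {0..<z 1}) = {(real m - 1) / real m}"
        by blast
      then show ?thesis by cases (simp_all add: measure_def)
    qed
    moreover have "grid_cell m j \<in> sets borel" for j by (simp add: grid_cell_def)
    ultimately show ?thesis unfolding u
      using measure_Un3[OF fm fm, of "grid_cell m (m - 2)" "grid_cell m (m - 1)"] by simp
  qed
  have merged: "measure (leb d) (merged_box d m \<inter> anchored_box d z)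
      = (\<Prod>i=1..d. measure lborel ({corner m i..1} \<inter> {0..<z i}))"
    unfolding merged_box_eq[OF m] PiE_Int_anchored_box by (rule measure_leb_PiE) auto
  have tails: "(\<Prod>i=2..d. measure lborel (grid_cell m (lower_index d m i) \<inter> {0..<z i}))
        = (\<Prod>i=2..d. measure lborel ({corner m i..1} \<inter> {0..<z i}))"
      "(\<Prod>i=2..d. measure lborel (grid_cell m (upper_index d m i) \<inter> {0..<z i}))
        = (\<Prod>i=2..d. measure lborel ({corner m i..1} \<inter> {0..<z i}))"
    by (auto intro!: prod.cong simp: lower_index_def upper_index_def hi[unfolded One_nat_def] corner_def)
  have "lower_index d m 1 = m - 2" "upper_index d m 1 = m - 1"
    using assms(1) by (auto simp: lower_index_def upper_index_def)
  then show ?thesis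
    unfolding measure_grid_cube_Int merged prod_atLeast1_remove1[OF assms(1)] tails head
    by (simp only: distrib_right)
qed

section \<open>The two halves of the merged box\<close>

text \<open>
  The oblique segment that cuts the merged box in two lies on the line $x_1 + 2 x_2 = 3 - 2/m$: it
  joins $(1, 1 - 1/m)$ to $(1 - 2/m, 1)$ in the first two coordinates.
\<close>

definition cut_value :: "nat \<Rightarrow> real" where
  "cut_value m = 3 - 2 / real m"

text \<open>
  In barycentric coordinates $(u,v,w)$ the triangle is given by $v, w \<ge> 0$ and $v + w \<le> 1$; here \<open>v\<close>
  and \<open>w\<close> are the rescaled offsets from the right angle, and $v + w \<le> 1$ is the half-plane
  condition.
\<close>

lemma Omega1_star_eq:
  assumes "2 \<le> d" "0 < m"
  shows "Omega1_star d m = {x \<in> merged_box d m. x 1 + 2 * x 2 \<le> cut_value m}"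
proof -
  have m: "0 < real m" using assms by simp
  have hull: "(s, t) \<in> convex hull {(corner m 1, corner m 2), (corner m 1 + 2 * (1 / real m), corner m 2),
        (corner m 1, corner m 2 + 1 / real m)}
      \<longleftrightarrow> corner m 1 \<le> s \<and> s \<le> 1 \<and> corner m 2 \<le> t \<and> t \<le> 1 \<and> s + 2 * t \<le> cut_value m" (is "?L \<longleftrightarrow> ?R") for s t
  proof
    assume ?L
    then obtain u v w where uvw: "0 \<le> u" "0 \<le> v" "0 \<le> w" "u + v + w = 1"
      and s: "s = u * corner m 1 + v * (corner m 1 + 2 * (1 / real m)) + w * corner m 1"
      and t: "t = u * corner m 2 + v * corner m 2 + w * (corner m 2 + 1 / real m)"
      unfolding convex_hull_3 by auto
    have "s = (u + v + w) * corner m 1 + 2 * v / real m" "t = (u + v + w) * corner m 2 + w / real m"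
      unfolding s t by (simp_all add: algebra_simps)
    then have st: "s = corner m 1 + 2 * v / real m" "t = corner m 2 + w / real m"
      unfolding uvw by simp_all
    show ?R
      unfolding st cut_value_def corner_def using uvw m by (auto simp: divide_simps)
  next
    assume R: ?R
    define v where "v = real m * (s - corner m 1) / 2"
    define w where "w = real m * (t - corner m 2)"
    have "0 \<le> v" "0 \<le> w" using R m by (auto simp: v_def w_def)
    moreover have "v + w \<le> 1"
    proof -
      have "v + w = real m / 2 * (s + 2 * t - (3 - 4 / real m))"
        using m by (simp add: v_def w_def corner_def field_simps)
      also have "\<dots> \<le> real m / 2 * (cut_value m - (3 - 4 / real m))"
        using R m by (intro mult_left_mono) auto
      also have "\<dots> = 1" using m by (simp add: cut_value_def field_simps)
      finally show ?thesis .
    qed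
    moreover have "s = corner m 1 + 2 * v / real m" "t = corner m 2 + w / real m"
      using m by (simp_all add: v_def w_def)
    ultimately show ?L
      unfolding convex_hull_3
      by (intro CollectI exI[of _ "1 - v - w"] exI[of _ v] exI[of _ w]) (auto simp: algebra_simps)
  qed
  have split: "(\<forall>i\<in>{1..d}. Q i) \<longleftrightarrow> Q 1 \<and> Q 2 \<and> (\<forall>i\<in>{3..d}. Q i)" for Q
  proof -
    have "{1..d} = {1, 2} \<union> {3..d}" using assms(1) by auto
    then show ?thesis by auto
  qed
  have c3: "corner m i + 1 / real m = 1" if "i \<in> {3..d}" for i
    using that m by (auto simp: corner_def field_simps)
  show ?thesis
    unfolding Omega1_star_def Let_def hull merged_box_eq[OF assms(2)] PiE_iff split
    using c3 by (auto simp: PiE_iff)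
qed

text \<open>
  Taking the closure adds exactly the points on the cut. They are limits of points beyond the
  cut because the segment from any point of the closed half to the far corner $(1, \dots, 1)$ of
  the box enters the open half-space at once.
\<close>

lemma Omega2_star_eq:
  assumes "2 \<le> d" "2 \<le> m"
  shows "Omega2_star d m = {x \<in> merged_box d m. cut_value m \<le> x 1 + 2 * x 2}" (is "_ = ?H")
proof
  have m: "0 < m" using assms by simp
  have diff: "merged_box d m - Omega1_star d m = {x \<in> merged_box d m. cut_value m < x 1 + 2 * x 2}"
    using assms m by (auto simp: Omega1_star_eq)
  have "closed (\<Pi>\<^sub>E i\<in>{1..d}. {corner m i..1})"
  proof -
    have "(\<Pi>\<^sub>E i\<in>{1..d}. {corner m i..1})
        = (\<Inter>i\<in>{1..d}. (\<lambda>x. x i) -` {corner m i..1}) \<inter> (\<Inter>i\<in>- {1..d}. (\<lambda>x. x i) -` {undefined})"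
      unfolding PiE_def Pi_def extensional_def by blast
    also have "closed \<dots>"
      by (intro closed_Int closed_INT ballI closed_vimage continuous_on_product_coordinates) auto
    finally show ?thesis .
  qed
  moreover have "closed {x::nat \<Rightarrow> real. cut_value m \<le> x 1 + 2 * x 2}"
    by (intro closed_Collect_le continuous_intros continuous_on_product_coordinates)
  ultimately have "closed ?H"
    unfolding merged_box_eq[OF m] Collect_conj_eq Collect_mem_eq by (rule closed_Int)
  then show "Omega2_star d m \<subseteq> ?H"
    unfolding Omega2_star_def diff by (intro closure_minimal) auto
  show "?H \<subseteq> Omega2_star d m"
  proof
    fix x assume x: "x \<in> ?H"
    \<comment> \<open>The segment from \<open>x\<close> to the far corner $(1, \dots, 1)$.\<close>
    define f where "f \<epsilon> = (\<lambda>i. if i \<in> {1..d} then x i + \<epsilon> * (1 - x i) else undefined)" for \<epsilon> :: real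
    have x_box: "corner m i \<le> x i" "x i \<le> 1" if "i \<in> {1..d}" for i
      using x that unfolding merged_box_eq[OF m] by auto
    have "continuous_on UNIV f"
      unfolding f_def
    proof (rule continuous_on_coordinatewise_then_product)
      show "continuous_on UNIV (\<lambda>\<epsilon>. if i \<in> {1..d} then x i + \<epsilon> * (1 - x i) else undefined)" for i
        by (cases "i \<in> {1..d}") (auto intro!: continuous_intros)
    qed
    then have "f ` closure {0<..<1} \<subseteq> closure (f ` {0<..<1})"
      by (intro image_closure_subset closure_subset closed_closure) (rule continuous_on_subset, auto)
    moreover have "f 0 = x"
    proof
      fix i
      have "x \<in> (\<Pi>\<^sub>E i\<in>{1..d}. {corner m i..1})"
        using x unfolding merged_box_eq[OF m] by simp
      then have "i \<notin> {1..d} \<Longrightarrow> x i = undefined"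
        by (rule PiE_arb)
      then show "f 0 i = x i"
        unfolding f_def by (metis add_0_right mult_zero_left)
    qed
    moreover have "(0::real) \<in> closure {0<..<1}" by simp
    ultimately have "x \<in> closure (f ` {0<..<1})" by blast
    moreover have "f ` {0<..<1} \<subseteq> merged_box d m - Omega1_star d m"
    proof
      fix y assume "y \<in> f ` {0<..<1}"
      then obtain \<epsilon> where \<epsilon>: "0 < \<epsilon>" "\<epsilon> < 1" and y: "y = f \<epsilon>" by auto
      have "y \<in> merged_box d m"
        unfolding merged_box_eq[OF m]
      proof (rule PiE_I)
        fix i assume i: "i \<in> {1..d}"
        have "0 \<le> \<epsilon> * (1 - x i)" using \<epsilon> x_box(2)[OF i] by simp
        moreover have "\<epsilon> * (1 - x i) \<le> 1 * (1 - x i)" using \<epsilon> x_box(2)[OF i] by (intro mult_right_mono) auto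
        ultimately have "x i \<le> x i + \<epsilon> * (1 - x i)" "x i + \<epsilon> * (1 - x i) \<le> 1" by auto
        then show "y i \<in> {corner m i..1}" using x_box(1)[OF i] i by (auto simp: y f_def)
      qed (auto simp: y f_def)
      moreover have "cut_value m < y 1 + 2 * y 2"
      proof -
        have "y 1 + 2 * y 2 = (1 - \<epsilon>) * (x 1 + 2 * x 2) + \<epsilon> * 3"
          using assms(1) by (simp add: y f_def algebra_simps)
        moreover have "(1 - \<epsilon>) * cut_value m \<le> (1 - \<epsilon>) * (x 1 + 2 * x 2)"
          using x \<epsilon> by (intro mult_left_mono) auto
        moreover have "\<epsilon> * cut_value m < \<epsilon> * 3"
          using \<epsilon> m by (simp add: cut_value_def)
        ultimately show ?thesis by (simp add: algebra_simps)
      qed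
      ultimately show "y \<in> merged_box d m - Omega1_star d m" unfolding diff by simp
    qed
    ultimately show "x \<in> Omega2_star d m"
      unfolding Omega2_star_def using closure_mono by blast
  qed
qed

text \<open>Cavalieri's principle for the first coordinate.\<close>

lemma emeasure_leb_sections:
  assumes "1 \<le> d" "A \<in> sets (leb d)"
  shows "emeasure (leb d) A
           = (\<integral>\<^sup>+ y. emeasure lborel {s. y(1 := s) \<in> A} \<partial>(\<Pi>\<^sub>M i\<in>{2..d}. lborel))"
proof -
  have ins: "insert 1 {2..d} = {1..d}" using assms(1) by auto
  have A: "A \<in> sets (\<Pi>\<^sub>M i\<in>insert 1 {2..d}. lborel)"
    using assms(2) unfolding ins leb_def .
  have "emeasure (leb d) A = (\<integral>\<^sup>+ x. indicator A x \<partial>(\<Pi>\<^sub>M i\<in>insert 1 {2..d}. lborel))"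
    using A unfolding ins leb_def by simp
  also have "\<dots> = (\<integral>\<^sup>+ y. (\<integral>\<^sup>+ s. indicator A (y(1 := s)) \<partial>lborel) \<partial>(\<Pi>\<^sub>M i\<in>{2..d}. lborel))"
    using A by (intro product_sigma_finite.product_nn_integral_insert[OF product_sigma_finite_lborel]) auto
  also have "\<dots> = (\<integral>\<^sup>+ y. emeasure lborel {s. y(1 := s) \<in> A} \<partial>(\<Pi>\<^sub>M i\<in>{2..d}. lborel))"
  proof (rule nn_integral_cong)
    fix y assume y: "y \<in> space (\<Pi>\<^sub>M i\<in>{2..d}. (lborel :: real measure))"
    have "(\<lambda>s. y(1 := s)) \<in> measurable lborel (\<Pi>\<^sub>M i\<in>insert 1 {2..d}. lborel)"
      using y by (intro measurable_fun_upd[where J = "{2..d}"]) auto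
    from measurable_sets[OF this A] have "{s. y(1 := s) \<in> A} \<in> sets lborel"
      by (simp add: vimage_def)
    moreover have "indicator A (y(1 := s)) = (indicator {s. y(1 := s) \<in> A} s :: ennreal)" for s
      by (simp add: indicator_def)
    ultimately show "(\<integral>\<^sup>+ s. indicator A (y(1 := s)) \<partial>lborel) = emeasure lborel {s. y(1 := s) \<in> A}"
      by simp
  qed
  finally show ?thesis .
qed

lemma halfspace_sets:
  assumes "2 \<le> d"
  shows "{x \<in> merged_box d m. x 1 + 2 * x 2 \<le> c} \<in> sets (leb d)"
    and "{x \<in> merged_box d m. c \<le> x 1 + 2 * x 2} \<in> sets (leb d)"
    and "{x \<in> merged_box d m. x 1 + 2 * x 2 = c} \<in> sets (leb d)"
proof -
  have [measurable]: "(\<lambda>x. x 1) \<in> borel_measurable (leb d)" "(\<lambda>x. x 2) \<in> borel_measurable (leb d)"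
    using assms by (auto intro: measurable_leb_component)
  have [measurable]: "merged_box d m \<in> sets (leb d)" by (rule merged_box_in_sets)
  have sub: "{x \<in> merged_box d m. Q x} = merged_box d m \<inter> {x \<in> space (leb d). Q x}" for Q
    using sets.sets_into_space[OF merged_box_in_sets[of d m]] by auto
  show "{x \<in> merged_box d m. x 1 + 2 * x 2 \<le> c} \<in> sets (leb d)"
    "{x \<in> merged_box d m. c \<le> x 1 + 2 * x 2} \<in> sets (leb d)"
    "{x \<in> merged_box d m. x 1 + 2 * x 2 = c} \<in> sets (leb d)"
    unfolding sub by measurable
qed

lemma Omega_star_in_sets:
  assumes "2 \<le> d" "2 \<le> m"
  shows "Omega1_star d m \<in> sets (leb d)" "Omega2_star d m \<in> sets (leb d)"
  using assms halfspace_sets[OF assms(1)] Omega1_star_eq[of d m] Omega2_star_eq[of d m] by simp_all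

lemma emeasure_cut_line:
  assumes "2 \<le> d"
  shows "emeasure (leb d) {x \<in> merged_box d m. x 1 + 2 * x 2 = c} = 0"
proof -
  have "emeasure lborel {s. y(1 := s) \<in> {x \<in> merged_box d m. x 1 + 2 * x 2 = c}} = 0" for y
  proof -
    have "{s. y(1 := s) \<in> {x \<in> merged_box d m. x 1 + 2 * x 2 = c}} \<subseteq> {c - 2 * y 2}" by auto
    from subset_singletonD[OF this] show ?thesis
      by (elim disjE) (simp_all only: emeasure_empty emeasure_lborel_singleton)
  qed
  then show ?thesis
    using assms halfspace_sets(3)[OF assms] by (subst emeasure_leb_sections) simp_all
qed

text \<open>
  For fixed remaining coordinates \<open>y\<close> in the box, the section in the direction $x_1$ is an interval of
  length $2(1 - y_2)$, so the volume is $(1/m)^{d-2}$ times the integral of $2(1 - s)$ over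
  $[1 - 1/m, 1]$, which is $1/m^2$.
\<close>

lemma emeasure_Omega1_star:
  assumes "2 \<le> d" "2 \<le> m"
  shows "emeasure (leb d) (Omega1_star d m) = ennreal (1 / real (m ^ d))"
proof -
  have m: "0 < m" "0 < real m" using assms by auto
  \<comment> \<open>The section length $2(1 - y_2)$ is attached to the second coordinate, so that the integral
     over the remaining coordinates factorizes.\<close>
  define g where "g i s = (if i = 2 then ennreal (2 * (1 - s)) else 1) * indicator {1 - 1 / real m..1} s"
    for i :: nat and s :: real
  have c1: "corner m 1 = 1 - 2 / real m"
    using m by (auto simp: corner_def field_simps)
  have c2: "corner m i = 1 - 1 / real m" if "i \<noteq> 1" for i
    using m that by (auto simp: corner_def field_simps)
  have "emeasure (leb d) (Omega1_star d m)
      = (\<integral>\<^sup>+ y. emeasure lborel {s. y(1 := s) \<in> Omega1_star d m} \<partial>(\<Pi>\<^sub>M i\<in>{2..d}. lborel))"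
    using assms by (intro emeasure_leb_sections Omega_star_in_sets) auto
  also have "\<dots> = (\<integral>\<^sup>+ y. (\<Prod>i\<in>{2..d}. g i (y i)) \<partial>(\<Pi>\<^sub>M i\<in>{2..d}. lborel))"
  proof (rule nn_integral_cong)
    fix y assume "y \<in> space (\<Pi>\<^sub>M i\<in>{2..d}. (lborel :: real measure))"
    then have ext: "y \<in> extensional {2..d}" by (simp add: space_PiM PiE_def)
    have ins: "{1..d} = insert 1 {2..d}" using assms(1) by auto
    show "emeasure lborel {s. y(1 := s) \<in> Omega1_star d m} = (\<Prod>i\<in>{2..d}. g i (y i))"
    proof (cases "\<forall>i\<in>{2..d}. y i \<in> {1 - 1 / real m..1}")
      case True
      have y2: "1 - 1 / real m \<le> y 2" "y 2 \<le> 1" using True assms(1) by auto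
      have "y(1 := s) \<in> merged_box d m \<longleftrightarrow> s \<in> {1 - 2 / real m..1}" for s
        using True ext c1 c2 unfolding merged_box_eq[OF m(1)] PiE_iff ins
        by (auto simp: extensional_def)
      then have "y(1 := s) \<in> Omega1_star d m \<longleftrightarrow> s \<in> {1 - 2 / real m..1} \<and> s + 2 * y 2 \<le> cut_value m" for s
        unfolding Omega1_star_eq[OF assms(1) m(1)] by simp
      moreover have "cut_value m - 2 * y 2 \<le> 1"
        using y2(1) by (simp add: cut_value_def)
      ultimately have "{s. y(1 := s) \<in> Omega1_star d m} = {1 - 2 / real m..cut_value m - 2 * y 2}"
        by fastforce
      moreover have "1 - 2 / real m \<le> cut_value m - 2 * y 2"
        using y2 by (simp add: cut_value_def)
      ultimately have "emeasure lborel {s. y(1 := s) \<in> Omega1_star d m} = ennreal (2 * (1 - y 2))"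
        by (simp add: cut_value_def algebra_simps)
      moreover have "(\<Prod>i\<in>{2..d}. g i (y i)) = (\<Prod>i\<in>{2..d}. if i = 2 then ennreal (2 * (1 - y 2)) else 1)"
        using True by (intro prod.cong) (auto simp: g_def)
      ultimately show ?thesis using assms(1) by (simp add: prod.delta)
    next
      case False
      then obtain i where i: "i \<in> {2..d}" "y i \<notin> {1 - 1 / real m..1}" by blast
      have "{s. y(1 := s) \<in> Omega1_star d m} = {}"
      proof -
        have "y(1 := s) \<notin> merged_box d m" for s
        proof
          assume "y(1 := s) \<in> merged_box d m"
          then have "(y(1 := s)) i \<in> {corner m i..1}"
            using i(1) PiE_mem[of "y(1 := s)" "{1..d}" "\<lambda>i. {corner m i..1}" i]
            unfolding merged_box_eq[OF m(1)] ins by blast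
          moreover have "i \<noteq> 1" using i(1) by simp
          ultimately show False using i(2) c2 by simp
        qed
        then show ?thesis unfolding Omega1_star_eq[OF assms(1) m(1)] by blast
      qed
      moreover have "(\<Prod>i\<in>{2..d}. g i (y i)) = 0"
        using i(1) by (rule prod_zero[OF finite_atLeastAtMost bexI[rotated]]) (use i(2) in \<open>simp add: g_def\<close>)
      ultimately show ?thesis by simp
    qed
  qed
  also have "\<dots> = (\<Prod>i\<in>{2..d}. integral\<^sup>N lborel (g i))"
    by (intro product_sigma_finite.product_nn_integral_prod[OF product_sigma_finite_lborel])
       (auto simp: g_def)
  also have "\<dots> = (\<Prod>i\<in>{2..d}. ennreal (if i = 2 then 1 / real m ^ 2 else 1 / real m))"
  proof (intro prod.cong refl)
    fix i assume "i \<in> {2..d}"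
    show "integral\<^sup>N lborel (g i) = ennreal (if i = 2 then 1 / real m ^ 2 else 1 / real m)"
    proof (cases "i = 2")
      case True
      have "(\<integral>\<^sup>+ s. ennreal (2 * (1 - s)) * indicator {1 - 1 / real m..1} s \<partial>lborel)
          = ennreal (- (1 - 1)\<^sup>2 - - (1 - (1 - 1 / real m))\<^sup>2)"
        by (rule nn_integral_FTC_Icc) (auto intro!: derivative_eq_intros)
      moreover have "g i = (\<lambda>s. ennreal (2 * (1 - s)) * indicator {1 - 1 / real m..1} s)"
        using True by (auto simp: g_def)
      ultimately show ?thesis using True by (simp add: power_divide)
    next
      case False
      then have "g i = indicator {1 - 1 / real m..1}"
        by (auto simp: g_def)
      then show ?thesis using False m by simp
    qed
  qed
  also have "\<dots> = ennreal (\<Prod>i\<in>{2..d}. if i = 2 then 1 / real m ^ 2 else 1 / real m)"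
    by (rule prod_ennreal) simp
  also have "(\<Prod>i\<in>{2..d}. if i = 2 then 1 / real m ^ 2 else 1 / real m) = 1 / real (m ^ d)"
  proof -
    have "(\<Prod>i\<in>{2..d}. if i = 2 then 1 / real m ^ 2 else 1 / real m) = 1 / real m ^ 2 * (1 / real m) ^ (d - 2)"
      using assms(1) by (subst prod.remove[of _ 2]) (auto simp: power_divide numeral_2_eq_2)
    also have "\<dots> = 1 / real m ^ (2 + (d - 2))"
      by (simp only: power_add power_divide) simp
    finally show ?thesis
      using assms(1) by (simp only: le_add_diff_inverse of_nat_power)
  qed
  finally show ?thesis .
qed

text \<open>The two halves overlap only in the cut, which is a null set.\<close>

lemma emeasure_Omega_star_split:
  assumes "2 \<le> d" "2 \<le> m" "A \<in> sets (leb d)"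
  shows "emeasure (leb d) (Omega1_star d m \<inter> A) + emeasure (leb d) (Omega2_star d m \<inter> A)
           = emeasure (leb d) (merged_box d m \<inter> A)"
proof -
  have m: "0 < m" using assms by simp
  have meas: "Omega1_star d m \<inter> A \<in> sets (leb d)" "Omega2_star d m \<inter> A \<in> sets (leb d)"
    using assms Omega_star_in_sets by auto
  have "(Omega1_star d m \<inter> A) \<inter> (Omega2_star d m \<inter> A) \<subseteq> {x \<in> merged_box d m. x 1 + 2 * x 2 = cut_value m}"
    using assms m by (auto simp: Omega1_star_eq Omega2_star_eq)
  then have "emeasure (leb d) ((Omega1_star d m \<inter> A) \<inter> (Omega2_star d m \<inter> A)) = 0"
    by (rule emeasure_eq_0[OF halfspace_sets(3)[OF assms(1)] emeasure_cut_line[OF assms(1)]])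
  moreover have "(Omega1_star d m \<inter> A) \<union> (Omega2_star d m \<inter> A) = merged_box d m \<inter> A"
    using assms m by (auto simp: Omega1_star_eq Omega2_star_eq)
  ultimately show ?thesis
    using emeasure_Un_Int[OF meas] by simp
qed

lemma emeasure_merged_box:
  assumes "1 \<le> d" "0 < m"
  shows "emeasure (leb d) (merged_box d m) = ennreal (2 / real (m ^ d))"
proof -
  have "emeasure (leb d) (merged_box d m)
      = (\<Prod>i=1..d. ennreal ((if i = 1 then 2 else 1) * (1 / real m)))"
    unfolding merged_box_def by (subst emeasure_leb_PiE) (auto intro!: prod.cong)
  also have "\<dots> = ennreal (\<Prod>i=1..d. (if i = 1 then 2 else 1) * (1 / real m))"
    by (rule prod_ennreal) simp
  also have "(\<Prod>i=1..d. (if i = 1 then 2 else 1) * (1 / real m)) = 2 / real (m ^ d)"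
    using assms(1) by (simp only: prod.distrib) (simp add: power_divide prod.delta)
  finally show ?thesis .
qed

lemma emeasure_Omega2_star:
  assumes "2 \<le> d" "2 \<le> m"
  shows "emeasure (leb d) (Omega2_star d m) = ennreal (1 / real (m ^ d))"
proof -
  have m: "0 < m" using assms by simp
  have sub: "Omega1_star d m \<inter> space (leb d) = Omega1_star d m" "Omega2_star d m \<inter> space (leb d) = Omega2_star d m"
    "merged_box d m \<inter> space (leb d) = merged_box d m"
    using sets.sets_into_space[OF merged_box_in_sets[of d m]] assms m
    by (auto simp: Omega1_star_eq Omega2_star_eq)
  have "ennreal (1 / real (m ^ d)) + emeasure (leb d) (Omega2_star d m) = ennreal (2 / real (m ^ d))"
    using emeasure_Omega_star_split[OF assms sets.top] assms m
    unfolding sub by (simp add: emeasure_Omega1_star emeasure_merged_box)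
  also have "\<dots> = ennreal (1 / real (m ^ d)) + ennreal (1 / real (m ^ d))"
    by (simp flip: ennreal_plus)
  finally show ?thesis
    by (simp add: ennreal_add_left_cancel)
qed

section \<open>The minimum of the function P\<close>

text \<open>
  The value $-2/45$ is attained at $\tan\theta = 1/2$, and both branches of $P + 2/45$ vanish there
  to second order: with
  $t = \tan\theta$ and $c = \cot\theta$,
  $90\,(P + 2/45) = (2t - 1)^2 (t + 4)$ on the left branch and
  $1440\,(P + 2/45) = (c - 2)^2 (c + 16)$ on the right one.
\<close>

lemma P_fun_ge:
  assumes "\<theta> \<in> {0..pi / 2}"
  shows "- (2 / 45) \<le> P_fun \<theta>"
proof -
  have ar: "0 < arctan (1 / 2)" "arctan (1 / 2) < pi / 2"
    using arctan_ubound by (auto simp: zero_less_arctan_iff)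
  consider "\<theta> < arctan (1 / 2)" | "\<theta> = arctan (1 / 2)" | "arctan (1 / 2) < \<theta>" by linarith
  then show ?thesis
  proof cases
    case 1
    have "0 \<le> tan \<theta>" using assms 1 ar by (intro tan_pos_pi2_le) auto
    then have "0 \<le> (2 * tan \<theta> - 1)\<^sup>2 * (tan \<theta> + 4)" by simp
    also have "\<dots> = 90 * (P_fun \<theta> + 2 / 45)"
      using 1 by (simp add: P_fun_def power2_eq_square power3_eq_cube algebra_simps)
    finally show ?thesis by simp
  next
    case 2
    then show ?thesis by (simp add: P_fun_def)
  next
    case 3
    have "0 \<le> cot \<theta>"
    proof -
      have "0 < \<theta>" using 3 ar(1) by linarith
      then show ?thesis
        unfolding cot_def using assms
        by (intro divide_nonneg_nonneg sin_ge_zero cos_ge_zero) auto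
    qed
    then have "0 \<le> (cot \<theta> - 2)\<^sup>2 * (cot \<theta> + 16)" by simp
    also have "\<dots> = 1440 * (P_fun \<theta> + 2 / 45)"
      using 3 by (simp add: P_fun_def power2_eq_square power3_eq_cube algebra_simps)
    finally show ?thesis by simp
  qed
qed

section \<open>The modified partition\<close>

lemma inj_on_grid_cube:
  assumes "0 < m"
  shows "inj_on (grid_cube d m) (grid_indices d m)"
proof (rule inj_onI)
  fix k l assume k: "k \<in> grid_indices d m" and l: "l \<in> grid_indices d m"
    and eq: "grid_cube d m k = grid_cube d m l"
  have le: "real j / real m \<le> (real j + 1) / real m" for j
    using assms by (simp add: divide_simps)
  have ne: "grid_cell m j \<noteq> {}" for j
    using le[of j] unfolding grid_cell_def atLeastatMost_empty_iff by simp
  show "k = l"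
  proof (rule extensionalityI[where A = "{1..d}"])
    fix i assume "i \<in> {1..d}"
    then have "grid_cell m (k i) = grid_cell m (l i)"
      using eq ne unfolding grid_cube_def by (simp add: PiE_eq_iff_not_empty)
    then have "real (k i) / real m = real (l i) / real m"
      using le unfolding grid_cell_def Icc_eq_Icc by (meson order_trans)
    then show "k i = l i" using assms by simp
  qed (use k l in \<open>auto simp: PiE_iff\<close>)
qed

lemma is_Omega_star_image:
  assumes "1 \<le> d" "2 \<le> m" "is_Omega_star d m \<Omega>"
  shows "bij_betw \<Omega> {3..m ^ d}
           (grid_cube d m ` (grid_indices d m - {lower_index d m, upper_index d m}))"
proof -
  have "{Q \<in> grid_cubes d m. \<not> Q \<subseteq> merged_box d m}
      = grid_cube d m ` (grid_indices d m - {lower_index d m, upper_index d m})"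
    unfolding grid_cubes_eq using grid_cube_subset_merged_box_iff[OF assms(1,2)] by blast
  then show ?thesis using assms(3) by (simp add: is_Omega_star_def)
qed

lemma four_le_power:
  assumes "2 \<le> d" "2 \<le> (m::nat)"
  shows "4 \<le> m ^ d"
proof -
  have "(2::nat) ^ 2 \<le> m ^ 2" using assms by (intro power_mono) auto
  also have "\<dots> \<le> m ^ d" using assms by (intro power_increasing) auto
  finally show ?thesis by simp
qed

text \<open>
  Sums over the partition do not depend on the enumeration of the remaining cubes, so they can be
  taken over grid indices.
\<close>

lemma sum_Omega_star:
  fixes F :: "(nat \<Rightarrow> real) set \<Rightarrow> real"
  assumes "2 \<le> d" "2 \<le> m" "is_Omega_star d m \<Omega>"
  shows "(\<Sum>i=1..m ^ d. F (\<Omega> i)) = F (Omega1_star d m) + F (Omega2_star d m)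
           + (\<Sum>k\<in>grid_indices d m - {lower_index d m, upper_index d m}. F (grid_cube d m k))"
proof -
  let ?K = "grid_indices d m - {lower_index d m, upper_index d m}"
  have "{1..m ^ d} = insert 1 (insert 2 {3..m ^ d})"
    using four_le_power[OF assms(1,2)] by auto
  then have "(\<Sum>i=1..m ^ d. F (\<Omega> i)) = F (\<Omega> 1) + F (\<Omega> 2) + (\<Sum>i=3..m ^ d. F (\<Omega> i))"
    by simp
  moreover have "(\<Sum>i=3..m ^ d. F (\<Omega> i)) = (\<Sum>Q\<in>grid_cube d m ` ?K. F Q)"
    using assms by (intro sum.reindex_bij_betw is_Omega_star_image) auto
  moreover have "\<dots> = (\<Sum>k\<in>?K. F (grid_cube d m k))"
    using assms by (intro sum.reindex_cong[OF inj_on_subset[OF inj_on_grid_cube]]) auto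
  ultimately show ?thesis using assms(3) by (simp add: is_Omega_star_def)
qed

lemma Omega_star_cell_in_sets_volume:
  assumes "2 \<le> d" "2 \<le> m" "is_Omega_star d m \<Omega>" "i \<in> {1..m ^ d}"
  shows "\<Omega> i \<in> sets (leb d)" "emeasure (leb d) (\<Omega> i) = ennreal (1 / real (m ^ d))"
proof -
  consider "i = 1" | "i = 2" | "i \<in> {3..m ^ d}"
    using assms(4) by force
  then have "\<Omega> i \<in> {Omega1_star d m, Omega2_star d m} \<union> range (grid_cube d m)"
  proof cases
    case 3
    have "1 \<le> d" using assms(1) by simp
    from bij_betwE[OF is_Omega_star_image[OF this assms(2,3)]] 3 show ?thesis by blast
  qed (use assms(3) in \<open>auto simp: is_Omega_star_def\<close>)
  then show "\<Omega> i \<in> sets (leb d)" "emeasure (leb d) (\<Omega> i) = ennreal (1 / real (m ^ d))"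
    using assms(2) Omega_star_in_sets[OF assms(1,2)] emeasure_Omega1_star[OF assms(1,2)]
      emeasure_Omega2_star[OF assms(1,2)] grid_cube_in_sets emeasure_grid_cube[of m d]
    by auto
qed

text \<open>
  The two halves of the merged box together measure the same part of the test box as the two
  cubes that they replace, which reduces the claim to the regular grid.
\<close>

lemma sum_measure_Omega_star_Int:
  assumes "2 \<le> d" "2 \<le> m" "is_Omega_star d m \<Omega>" "z \<in> unit_cube d"
  shows "(\<Sum>i=1..m ^ d. measure (leb d) (\<Omega> i \<inter> anchored_box d z)) = measure (leb d) (anchored_box d z)"
proof -
  define F where "F S = measure (leb d) (S \<inter> anchored_box d z)" for S
  let ?K = "grid_indices d m - {lower_index d m, upper_index d m}"
  have d: "1 \<le> d" and m: "0 < m" using assms by auto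
  have "emeasure (leb d) (merged_box d m \<inter> anchored_box d z) \<le> emeasure (leb d) (merged_box d m)"
    by (intro emeasure_mono merged_box_in_sets) auto
  also have "\<dots> < \<top>" using d m by (simp add: emeasure_merged_box)
  finally have fin: "emeasure (leb d) (Omega1_star d m \<inter> anchored_box d z)
      + emeasure (leb d) (Omega2_star d m \<inter> anchored_box d z) < \<top>"
    by (simp add: emeasure_Omega_star_split[OF assms(1,2) anchored_box_in_sets])
  have "F (Omega1_star d m) + F (Omega2_star d m) = F (merged_box d m)"
    unfolding F_def measure_def emeasure_Omega_star_split[OF assms(1,2) anchored_box_in_sets, symmetric]
    using fin by (simp add: enn2real_plus)
  also have "\<dots> = F (grid_cube d m (lower_index d m)) + F (grid_cube d m (upper_index d m))"
    unfolding F_def by (rule measure_merged_box_Int[OF d assms(2,4)])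
  finally have "F (Omega1_star d m) + F (Omega2_star d m)
      = (\<Sum>k\<in>{lower_index d m, upper_index d m}. F (grid_cube d m k))"
    using lower_index_neq_upper_index[OF d assms(2)] by simp
  then have "(\<Sum>i=1..m ^ d. F (\<Omega> i))
      = (\<Sum>k\<in>{lower_index d m, upper_index d m}. F (grid_cube d m k)) + (\<Sum>k\<in>?K. F (grid_cube d m k))"
    using sum_Omega_star[OF assms(1-3), of F] by simp
  also have "\<dots> = (\<Sum>k\<in>grid_indices d m. F (grid_cube d m k))"
  proof -
    have "{lower_index d m, upper_index d m} \<subseteq> grid_indices d m"
      using assms(2) by (auto simp: lower_index_def upper_index_def)
    moreover have "finite (grid_indices d m)" by (intro finite_PiE) auto
    ultimately show ?thesis
      using sum.subset_diff[of "{lower_index d m, upper_index d m}" "grid_indices d m" "\<lambda>k. F (grid_cube d m k)"]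
      by (simp add: add.commute)
  qed
  also have "\<dots> = measure (leb d) (anchored_box d z)"
    unfolding F_def by (rule sum_measure_grid_cube_Int[OF m assms(4)])
  finally show ?thesis unfolding F_def .
qed

text \<open>
  The term $d\,m^{d-1}/4$ bounds the variances of the grid cubes and the term $1/2$ those of the two
  halves of the merged box.
\<close>

lemma expected_L2_discrepancy_sq_Omega_star_le:
  assumes "2 \<le> d" "2 \<le> m" "is_Omega_star d m \<Omega>"
  shows "expected_L2_discrepancy_sq d (m ^ d) \<Omega>
           \<le> (real d * real m ^ (d - 1) / 4 + 1 / 2) / real (m ^ d) ^ 2"
proof (rule expected_L2_discrepancy_sq_le)
  fix z assume z: "z \<in> unit_cube d"
  define q where "q S = real (m ^ d) * measure (leb d) (S \<inter> anchored_box d z)" for S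
  let ?K = "grid_indices d m - {lower_index d m, upper_index d m}"
  have "(\<Sum>k\<in>?K. q (grid_cube d m k) * (1 - q (grid_cube d m k))) \<le> real d * real m ^ (d - 1) / 4"
    unfolding q_def using assms(2) z by (intro sum_grid_cube_variances_le) auto
  moreover have "q (Omega1_star d m) * (1 - q (Omega1_star d m)) \<le> 1 / 4"
    "q (Omega2_star d m) * (1 - q (Omega2_star d m)) \<le> 1 / 4"
    by (rule mult_one_minus_le_quarter)+
  ultimately have "(\<Sum>i=1..m ^ d. q (\<Omega> i) * (1 - q (\<Omega> i))) \<le> real d * real m ^ (d - 1) / 4 + 1 / 2"
    using sum_Omega_star[OF assms, of "\<lambda>S. q S * (1 - q S)"]
    by linarith
  then show "(\<Sum>i=1..m ^ d. real (m ^ d) * measure (leb d) (\<Omega> i \<inter> anchored_box d z)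
        * (1 - real (m ^ d) * measure (leb d) (\<Omega> i \<inter> anchored_box d z)))
      \<le> real d * real m ^ (d - 1) / 4 + 1 / 2"
    unfolding q_def .
next
  show "1 \<le> m ^ d" using assms(2) by simp
  show "0 \<le> real d * real m ^ (d - 1) / 4 + 1 / 2" by simp
qed (rule Omega_star_cell_in_sets_volume[OF assms] sum_measure_Omega_star_Int[OF assms], assumption)+

section \<open>The discrepancy bound\<close>

theorem corollary3p7:
  fixes m d N :: nat and \<Omega> :: "nat \<Rightarrow> (nat \<Rightarrow> real) set"
  assumes "2 \<le> d" and "d \<le> m" and "N = m ^ d"
    and "is_Omega_star d m \<Omega>"
  shows "expected_L2_discrepancy_sq d N \<Omega>
           \<le> real d / real N powr (1 + 1 / real d) - 2 / 45 * (1 / real N ^ 3) * (1 / 3 ^ (d - 2))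
       \<and> (\<forall>\<theta>\<in>{0..pi / 2}.
             real d / real N powr (1 + 1 / real d) - 2 / 45 * (1 / real N ^ 3) * (1 / 3 ^ (d - 2))
               \<le> real d / real N powr (1 + 1 / real d) + 1 / real N ^ 3 * (1 / 3 ^ (d - 2)) * P_fun \<theta>)"
proof (intro conjI ballI)
  have m: "2 \<le> m" using assms by simp
  define X where "X = real d * real m ^ (d - 1)"
  define c where "c = 1 / (3::real) ^ (d - 2)"
  have N: "real N = real m * real m ^ (d - 1)"
    using assms(1,3) by (simp flip: power_Suc)
  have N1: "1 \<le> real N" using four_le_power[OF assms(1) m] assms(3) by linarith
  have "real N powr (1 / real d) = real m"
    using assms(1,3) m by (simp add: powr_powr flip: powr_realpow)
  then have "real N powr (1 + 1 / real d) = real N * real m"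
    using N1 by (simp add: powr_add)
  then have powr: "real d / real N powr (1 + 1 / real d) = X / real N ^ 2"
    using m unfolding X_def N by (simp add: power2_eq_square)
  have "(2::real) ^ 1 \<le> real m ^ 1"
    using m by simp
  also have "\<dots> \<le> real m ^ (d - 1)"
    using m assms(1) by (intro power_increasing) auto
  finally have "2 \<le> real m ^ (d - 1)"
    by simp
  \<comment> \<open>Since $X \<ge> 4$, the gap $3X/4$ absorbs both $1/2$ and the correction term of size at most
     $2/45$.\<close>
  then have "2 * 2 \<le> X"
    unfolding X_def using assms(1) by (intro mult_mono) auto
  moreover have "c \<le> 1" by (simp add: c_def)
  then have "c / real N \<le> 1"
    using N1 by (simp add: divide_le_eq)
  ultimately have "X / 4 + 1 / 2 \<le> X - 2 / 45 * (c / real N)" by linarith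
  then have "(X / 4 + 1 / 2) / real N ^ 2 \<le> (X - 2 / 45 * (c / real N)) / real N ^ 2"
    by (rule divide_right_mono) simp
  also have "\<dots> = X / real N ^ 2 - 2 / 45 * (1 / real N ^ 3) * c"
    by (simp add: diff_divide_distrib power2_eq_square power3_eq_cube mult.assoc)
  finally show "expected_L2_discrepancy_sq d N \<Omega>
      \<le> real d / real N powr (1 + 1 / real d) - 2 / 45 * (1 / real N ^ 3) * (1 / 3 ^ (d - 2))"
    using expected_L2_discrepancy_sq_Omega_star_le[OF assms(1) m assms(4)]
    unfolding powr unfolding X_def c_def assms(3) by linarith
next
  fix \<theta> assume "\<theta> \<in> {0..pi / 2}"
  then have "1 / real N ^ 3 * (1 / 3 ^ (d - 2)) * - (2 / 45) \<le> 1 / real N ^ 3 * (1 / 3 ^ (d - 2)) * P_fun \<theta>"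
    by (intro mult_left_mono P_fun_ge) auto
  then show "real d / real N powr (1 + 1 / real d) - 2 / 45 * (1 / real N ^ 3) * (1 / 3 ^ (d - 2))
      \<le> real d / real N powr (1 + 1 / real d) + 1 / real N ^ 3 * (1 / 3 ^ (d - 2)) * P_fun \<theta>"
    by (simp add: algebra_simps)
qed

end
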